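(* Let $A,B$ be disjoint finite sets and let $\mathcal V_{AB},\hat{\mathcal V}_{AB}$ be linkages, i.e. linear subspaces of $\mathbb F^{A\uplus B}$. Then 1. $(\mathcal V_{AB}+_b\hat{\mathcal V}_{AB})^{\perp}=\mathcal V_{AB}^{\perp}+_a\hat{\mathcal V}_{AB}^{\perp}$; 2. $(\mathcal V_{AB}+_b\hat{\mathcal V}_{AB})^{T}=\mathcal V_{AB}^{T}+_a\hat{\mathcal V}_{AB}^{T}$.
   Context: Fix a field $\mathbb F$; all index sets are finite. A vector on $X$ is a function $X\to\mathbb F$. For disjoint $A,B$ a vector on $A\uplus B$ is written $(f_A,f_B)$. $\mathcal V_{AB}$ denotes a linear subspace of the space of all vectors on $A\uplus B$ (a "linkage" with blocks $A,B$). $\mathcal V^\perp$ is the set of all $g$ with $\sum_e f(e)g(e)=0$ for all $f\in\mathcal V$. Intersection-sums: $\mathcal V_{AB}+_b\hat{\mathcal V}_{AB}:=\{(f_A,f_B^1+f_B^2):(f_A,f^1_B)\in\mathcal V_{AB},\ (f_A,f_B^2)\in\hat{\mathcal V}_{AB}\}$ and $\mathcal V_{AB}+_a\hat{\mathcal V}_{AB}:=\{(f^1_A+f^2_A,f_B):(f^1_A,f_B)\in\mathcal V_{AB},\ (f^2_A,f_B)\in\hat{\mathcal V}_{AB}\}$. Transpose: $\mathcal V_{AB}^T:=(\mathcal V_{AB}^\perp)_{A(-B)}:=\{(f_A,-f_B):(f_A,f_B)\in\mathcal V_{AB}^\perp\}$. *)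

theory Defs
  imports Complex_Main "HOL-Library.Function_Algebras"
begin

text \<open>
  A vector on \<open>X\<close> is represented by its extension by zero to the ambient type. This makes the
  vectors on \<open>X\<close> correspond bijectively and linearly to the functions from \<open>X\<close> to the field,
  also for empty \<open>X\<close>, and lets the pointwise operations of \<^theory>\<open>HOL-Library.Function_Algebras\<close>
  be used unchanged.
\<close>

definition vectors_on :: "'e set \<Rightarrow> ('e \<Rightarrow> 'f::field) set" where
  "vectors_on X = {f. \<forall>e. e \<notin> X \<longrightarrow> f e = 0}"

definition fun_scale :: "'f::field \<Rightarrow> ('e \<Rightarrow> 'f) \<Rightarrow> 'e \<Rightarrow> 'f" where
  "fun_scale c f = (\<lambda>e. c * f e)"

interpretation fun_space: vector_space "fun_scale :: 'f::field \<Rightarrow> ('e \<Rightarrow> 'f) \<Rightarrow> 'e \<Rightarrow> 'f"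
  by unfold_locales (auto simp: fun_scale_def fun_eq_iff algebra_simps)

definition linkage :: "'e set \<Rightarrow> 'e set \<Rightarrow> ('e \<Rightarrow> 'f::field) set \<Rightarrow> bool" where
  "linkage A B V \<longleftrightarrow> V \<subseteq> vectors_on (A \<union> B) \<and> fun_space.subspace V"

definition perp :: "'e set \<Rightarrow> ('e \<Rightarrow> 'f::field) set \<Rightarrow> ('e \<Rightarrow> 'f) set" where
  "perp X V = {g \<in> vectors_on X. \<forall>f\<in>V. (\<Sum>e\<in>X. f e * g e) = 0}"

text \<open>
  \<open>join A f g\<close> is the vector \<open>(f, g)\<close> on \<open>A \<union> B\<close>, for \<open>f\<close> on \<open>A\<close> and \<open>g\<close> on \<open>B\<close> with \<open>A\<close>, \<open>B\<close>
  disjoint; \<open>B\<close> need not be given since \<open>g\<close> vanishes outside it.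
\<close>

definition join :: "'e set \<Rightarrow> ('e \<Rightarrow> 'f::field) \<Rightarrow> ('e \<Rightarrow> 'f) \<Rightarrow> 'e \<Rightarrow> 'f" where
  "join A f g = (\<lambda>e. if e \<in> A then f e else g e)"

definition intersection_sum_snd ::
  "'e set \<Rightarrow> 'e set \<Rightarrow> ('e \<Rightarrow> 'f::field) set \<Rightarrow> ('e \<Rightarrow> 'f) set \<Rightarrow> ('e \<Rightarrow> 'f) set" where
  "intersection_sum_snd A B V W =
    {join A f (g1 + g2) | f g1 g2.
      f \<in> vectors_on A \<and> g1 \<in> vectors_on B \<and> g2 \<in> vectors_on B \<and>
      join A f g1 \<in> V \<and> join A f g2 \<in> W}"

definition intersection_sum_fst ::
  "'e set \<Rightarrow> 'e set \<Rightarrow> ('e \<Rightarrow> 'f::field) set \<Rightarrow> ('e \<Rightarrow> 'f) set \<Rightarrow> ('e \<Rightarrow> 'f) set" where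
  "intersection_sum_fst A B V W =
    {join A (f1 + f2) g | f1 f2 g.
      f1 \<in> vectors_on A \<and> f2 \<in> vectors_on A \<and> g \<in> vectors_on B \<and>
      join A f1 g \<in> V \<and> join A f2 g \<in> W}"

definition negate_snd ::
  "'e set \<Rightarrow> 'e set \<Rightarrow> ('e \<Rightarrow> 'f::field) set \<Rightarrow> ('e \<Rightarrow> 'f) set" where
  "negate_snd A B V =
    {join A f (- g) | f g. f \<in> vectors_on A \<and> g \<in> vectors_on B \<and> join A f g \<in> V}"

definition transpose_linkage ::
  "'e set \<Rightarrow> 'e set \<Rightarrow> ('e \<Rightarrow> 'f::field) set \<Rightarrow> ('e \<Rightarrow> 'f) set" where
  "transpose_linkage A B V = negate_snd A B (perp (A \<union> B) V)"

end

theory Submission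
  imports Defs
begin

text \<open>
  The inclusion of \<open>V\<^sup>\<bottom> +\<^sub>a W\<^sup>\<bottom>\<close> in \<open>(V +\<^sub>b W)\<^sup>\<bottom>\<close> is bilinearity: pairing \<open>(p\<^sub>1 + p\<^sub>2, q)\<close> with
  \<open>(a, b\<^sub>1 + b\<^sub>2)\<close> gives the pairing of \<open>(p\<^sub>1, q)\<close> with \<open>(a, b\<^sub>1)\<close> plus that of \<open>(p\<^sub>2, q)\<close> with
  \<open>(a, b\<^sub>2)\<close>.

  Conversely let \<open>(p, q)\<close> be orthogonal to \<open>V +\<^sub>b W\<close>. A vector \<open>u\<close> on \<open>A\<close> is wanted such that \<open>(u, q)\<close>
  is orthogonal to \<open>V\<close> and \<open>(p - u, q)\<close> is orthogonal to \<open>W\<close>. This prescribes the pairing of \<open>u\<close>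
  with the \<open>A\<close>-part of every vector of \<open>V\<close> and of every vector of \<open>W\<close>, hence with \<open>a + a'\<close> for
  all \<open>(a, b) \<in> V\<close> and \<open>(a', b') \<in> W\<close>. Such a linear system is solvable as soon as it is
  consistent, that is, as soon as \<open>a + a' = 0\<close> forces the prescribed value to vanish
  (\<open>consistent_system_solvable\<close>). But if \<open>a' = - a\<close>, then \<open>(a, b) \<in> V\<close> and \<open>(a, - b') \<in> W\<close>
  combine to the element \<open>(a, b - b')\<close> of \<open>V +\<^sub>b W\<close>, and its orthogonality to \<open>(p, q)\<close> says
  exactly that the value vanishes.

  The transposed identity follows from the first one, because \<open>+\<^sub>a\<close> requires the \<open>B\<close>-parts of both
  summands to agree and therefore commutes with negating them.
\<close>

section \<open>Solvability of consistent linear systems\<close>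

text \<open>
  A pair \<open>(a, c)\<close> stands for the equation \<open>\<Sum>i\<in>I. u i * a i = c\<close> in the unknown \<open>u\<close>. The system may
  be infinite, but the unknowns are finitely many, so they can be eliminated one at a time: the
  equations whose coefficients vanish on \<open>I\<close> all prescribe the same value for a further unknown
  \<open>u x\<close>, and substituting it leaves a consistent system in the unknowns in \<open>I\<close>.
\<close>

lemma consistent_system_solvable:
  fixes R :: "(('i \<Rightarrow> 'f::field) \<times> 'f) set"
  assumes "finite I"
    and closed: "\<And>a c a' c' s. (a, c) \<in> R \<Longrightarrow> (a', c') \<in> R \<Longrightarrow>
                    ((\<lambda>i. a i - s * a' i), c - s * c') \<in> R"
    and consistent: "\<And>a c. (a, c) \<in> R \<Longrightarrow> (\<And>i. i \<in> I \<Longrightarrow> a i = 0) \<Longrightarrow> c = 0"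
  shows "\<exists>u. \<forall>(a, c)\<in>R. (\<Sum>i\<in>I. u i * a i) = c"
  using assms
proof (induction I arbitrary: R rule: finite_induct)
  case empty
  then show ?case by auto
next
  case (insert x I)
  have "\<exists>t. \<forall>(a, c)\<in>R. (\<forall>i\<in>I. a i = 0) \<longrightarrow> c = t * a x"
  proof (cases "\<exists>a c. (a, c) \<in> R \<and> (\<forall>i\<in>I. a i = 0) \<and> a x \<noteq> 0")
    case True
    then obtain a\<^sub>0 c\<^sub>0 where a\<^sub>0: "(a\<^sub>0, c\<^sub>0) \<in> R" "\<And>i. i \<in> I \<Longrightarrow> a\<^sub>0 i = 0" "a\<^sub>0 x \<noteq> 0"
      by blast
    have "c = c\<^sub>0 / a\<^sub>0 x * a x" if ac: "(a, c) \<in> R" "\<forall>i\<in>I. a i = 0" for a c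
    proof -
      have "((\<lambda>i. a i - a x / a\<^sub>0 x * a\<^sub>0 i), c - a x / a\<^sub>0 x * c\<^sub>0) \<in> R"
        using ac(1) a\<^sub>0(1) by (rule insert.prems(1))
      then have "c - a x / a\<^sub>0 x * c\<^sub>0 = 0"
        by (rule insert.prems(2)) (use ac(2) a\<^sub>0 in auto)
      then show ?thesis by (simp add: field_simps)
    qed
    then show ?thesis by blast
  next
    case False
    then have "c = 0 * a x" if "(a, c) \<in> R" "\<forall>i\<in>I. a i = 0" for a c
      using insert.prems(2)[OF that(1)] that by auto
    then show ?thesis by blast
  qed
  then obtain t where t: "\<And>a c. (a, c) \<in> R \<Longrightarrow> \<forall>i\<in>I. a i = 0 \<Longrightarrow> c = t * a x"
    by blast
  let ?R = "{(a, c - t * a x) | a c. (a, c) \<in> R}"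
  have "\<exists>u. \<forall>(a, c)\<in>?R. (\<Sum>i\<in>I. u i * a i) = c"
  proof (rule insert.IH)
    fix a c a' c' s
    assume "(a, c) \<in> ?R" "(a', c') \<in> ?R"
    then obtain d d' where d: "(a, d) \<in> R" "c = d - t * a x" "(a', d') \<in> R" "c' = d' - t * a' x"
      by blast
    have "c - s * c' = (d - s * d') - t * (a x - s * a' x)"
      unfolding d by (simp add: algebra_simps)
    with insert.prems(1)[OF d(1,3), of s]
    show "((\<lambda>i. a i - s * a' i), c - s * c') \<in> ?R" by blast
  next
    fix a c
    assume "(a, c) \<in> ?R" and "\<And>i. i \<in> I \<Longrightarrow> a i = 0"
    then show "c = 0" using t by auto
  qed
  then obtain u where u: "\<And>a c. (a, c) \<in> R \<Longrightarrow> (\<Sum>i\<in>I. u i * a i) = c - t * a x"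
    by fastforce
  have "(\<Sum>i\<in>insert x I. (u(x := t)) i * a i) = c" if "(a, c) \<in> R" for a c
  proof -
    have "(\<Sum>i\<in>I. (u(x := t)) i * a i) = (\<Sum>i\<in>I. u i * a i)"
      by (rule sum.cong) (use insert.hyps in auto)
    then show ?thesis using u[OF that] insert.hyps by simp
  qed
  then show ?case by blast
qed

section \<open>Coordinatewise descriptions of the operations on linkages\<close>

text \<open>
  Decomposing and reassembling blocks is pure bookkeeping. It is confined to this section, whose
  membership criteria let the algebra be carried out on whole vectors and their values at points of
  \<open>A\<close> and \<open>B\<close>.
\<close>

lemma join_blocks:
  fixes f :: "'e \<Rightarrow> 'f::field"
  assumes "f \<in> vectors_on (A \<union> B)" and "A \<inter> B = {}"
  obtains a b where "a \<in> vectors_on A" "b \<in> vectors_on B" "join A a b = f"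
    "\<And>e. e \<in> A \<Longrightarrow> a e = f e" "\<And>e. e \<in> B \<Longrightarrow> b e = f e"
proof
  show "(\<lambda>e. if e \<in> A then f e else 0) \<in> vectors_on A"
    and "(\<lambda>e. if e \<in> B then f e else 0) \<in> vectors_on B"
    by (auto simp: vectors_on_def)
  show "join A (\<lambda>e. if e \<in> A then f e else 0) (\<lambda>e. if e \<in> B then f e else 0) = f"
    using assms by (auto simp: join_def vectors_on_def fun_eq_iff)
qed auto

lemma join_eqI:
  fixes h :: "'e \<Rightarrow> 'f::field"
  assumes "h \<in> vectors_on (A \<union> B)" "b \<in> vectors_on B"
    and "\<And>e. e \<in> A \<Longrightarrow> a e = h e" and "\<And>e. e \<in> B \<Longrightarrow> b e = h e"
  shows "join A a b = h"
  using assms by (fastforce simp: join_def vectors_on_def fun_eq_iff)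

lemma mem_intersection_sum_snd_iff:
  fixes V W :: "('e \<Rightarrow> 'f::field) set"
  assumes disj: "A \<inter> B = {}" and sub: "V \<subseteq> vectors_on (A \<union> B)" "W \<subseteq> vectors_on (A \<union> B)"
  shows "h \<in> intersection_sum_snd A B V W \<longleftrightarrow> h \<in> vectors_on (A \<union> B) \<and>
    (\<exists>v\<in>V. \<exists>w\<in>W. (\<forall>e\<in>A. v e = h e \<and> w e = h e) \<and> (\<forall>e\<in>B. h e = v e + w e))"
    (is "_ \<longleftrightarrow> ?rhs")
proof
  assume "h \<in> intersection_sum_snd A B V W"
  then obtain f g1 g2 where h: "h = join A f (g1 + g2)" "f \<in> vectors_on A" "g1 \<in> vectors_on B"
    "g2 \<in> vectors_on B" and V: "join A f g1 \<in> V" and W: "join A f g2 \<in> W"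
    by (auto simp: intersection_sum_snd_def)
  have "h \<in> vectors_on (A \<union> B)"
    using h by (auto simp: join_def vectors_on_def)
  moreover have "(\<forall>e\<in>A. join A f g1 e = h e \<and> join A f g2 e = h e) \<and>
      (\<forall>e\<in>B. h e = join A f g1 e + join A f g2 e)"
    using h(1) disj by (auto simp: join_def)
  ultimately show ?rhs using V W by blast
next
  assume ?rhs
  then obtain v w where h: "h \<in> vectors_on (A \<union> B)" and v: "v \<in> V" and w: "w \<in> W"
    and eq: "\<And>e. e \<in> A \<Longrightarrow> v e = h e" "\<And>e. e \<in> A \<Longrightarrow> w e = h e"
      "\<And>e. e \<in> B \<Longrightarrow> h e = v e + w e"
    by blast
  have vo: "v \<in> vectors_on (A \<union> B)" and wo: "w \<in> vectors_on (A \<union> B)" using sub v w by auto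
  obtain f g1 where f: "f \<in> vectors_on A" "g1 \<in> vectors_on B" "join A f g1 = v"
    "\<And>e. e \<in> A \<Longrightarrow> f e = v e" "\<And>e. e \<in> B \<Longrightarrow> g1 e = v e"
    using join_blocks[OF vo disj] by metis
  obtain f' g2 where g: "g2 \<in> vectors_on B" "\<And>e. e \<in> B \<Longrightarrow> g2 e = w e"
    using join_blocks[OF wo disj] by metis
  have "join A f g2 = w" by (rule join_eqI[OF wo g(1)]) (use eq f g in auto)
  moreover have "join A f (g1 + g2) = h"
    by (rule join_eqI[OF h]) (use eq f g in \<open>auto simp: vectors_on_def\<close>)
  ultimately show "h \<in> intersection_sum_snd A B V W"
    unfolding intersection_sum_snd_def using f g v w by blast
qed

lemma mem_intersection_sum_fst_iff:
  fixes V W :: "('e \<Rightarrow> 'f::field) set"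
  assumes disj: "A \<inter> B = {}" and sub: "V \<subseteq> vectors_on (A \<union> B)" "W \<subseteq> vectors_on (A \<union> B)"
  shows "h \<in> intersection_sum_fst A B V W \<longleftrightarrow> h \<in> vectors_on (A \<union> B) \<and>
    (\<exists>v\<in>V. \<exists>w\<in>W. (\<forall>e\<in>A. h e = v e + w e) \<and> (\<forall>e\<in>B. v e = h e \<and> w e = h e))"
    (is "_ \<longleftrightarrow> ?rhs")
proof
  assume "h \<in> intersection_sum_fst A B V W"
  then obtain f1 f2 g where h: "h = join A (f1 + f2) g" "f1 \<in> vectors_on A" "f2 \<in> vectors_on A"
    "g \<in> vectors_on B" and V: "join A f1 g \<in> V" and W: "join A f2 g \<in> W"
    by (auto simp: intersection_sum_fst_def)
  have "h \<in> vectors_on (A \<union> B)"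
    using h by (auto simp: join_def vectors_on_def)
  moreover have "(\<forall>e\<in>A. h e = join A f1 g e + join A f2 g e) \<and>
      (\<forall>e\<in>B. join A f1 g e = h e \<and> join A f2 g e = h e)"
    using h(1) disj by (auto simp: join_def)
  ultimately show ?rhs using V W by blast
next
  assume ?rhs
  then obtain v w where h: "h \<in> vectors_on (A \<union> B)" and v: "v \<in> V" and w: "w \<in> W"
    and eq: "\<And>e. e \<in> A \<Longrightarrow> h e = v e + w e" "\<And>e. e \<in> B \<Longrightarrow> v e = h e"
      "\<And>e. e \<in> B \<Longrightarrow> w e = h e"
    by blast
  have vo: "v \<in> vectors_on (A \<union> B)" and wo: "w \<in> vectors_on (A \<union> B)" using sub v w by auto
  obtain f1 g where f: "f1 \<in> vectors_on A" "g \<in> vectors_on B" "join A f1 g = v"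
    "\<And>e. e \<in> A \<Longrightarrow> f1 e = v e" "\<And>e. e \<in> B \<Longrightarrow> g e = v e"
    using join_blocks[OF vo disj] by metis
  obtain f2 g' where g: "f2 \<in> vectors_on A" "\<And>e. e \<in> A \<Longrightarrow> f2 e = w e"
    using join_blocks[OF wo disj] by metis
  have "join A f2 g = w" by (rule join_eqI[OF wo f(2)]) (use eq f g in auto)
  moreover have "join A (f1 + f2) g = h"
    by (rule join_eqI[OF h f(2)]) (use eq f g in auto)
  ultimately show "h \<in> intersection_sum_fst A B V W"
    unfolding intersection_sum_fst_def using f g v w by blast
qed

lemma join_uminus_eq:
  fixes f g :: "'e \<Rightarrow> 'f::field"
  assumes "A \<inter> B = {}" "g \<in> vectors_on B"
  shows "join A f (- g) = (\<lambda>e. if e \<in> B then - join A f g e else join A f g e)"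
  using assms by (auto simp: join_def vectors_on_def fun_eq_iff)

text \<open>
  Negating the \<open>B\<close>-part is an involution on vectors, so membership in \<open>negate_snd A B V\<close> can be tested
  by applying it once more.
\<close>

lemma mem_negate_snd_iff:
  fixes V :: "('e \<Rightarrow> 'f::field) set"
  assumes disj: "A \<inter> B = {}" and sub: "V \<subseteq> vectors_on (A \<union> B)"
  shows "h \<in> negate_snd A B V \<longleftrightarrow> (\<lambda>e. if e \<in> B then - h e else h e) \<in> V" (is "_ \<longleftrightarrow> ?n h \<in> V")
proof
  assume "h \<in> negate_snd A B V"
  then obtain f g where "h = join A f (- g)" "g \<in> vectors_on B" "join A f g \<in> V"
    by (auto simp: negate_snd_def)
  moreover from this have "?n h = join A f g" by (simp add: join_uminus_eq[OF disj] fun_eq_iff)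
  ultimately show "?n h \<in> V" by simp
next
  assume n: "?n h \<in> V"
  then have "?n h \<in> vectors_on (A \<union> B)" using sub by auto
  then obtain f g where fg: "f \<in> vectors_on A" "g \<in> vectors_on B" "join A f g = ?n h"
    by (rule join_blocks[OF _ disj])
  then have "join A f (- g) = h" by (simp add: join_uminus_eq[OF disj] fun_eq_iff)
  moreover have "join A f g \<in> V" using fg(3) n by simp
  ultimately show "h \<in> negate_snd A B V" unfolding negate_snd_def using fg(1,2) by blast
qed

lemma negate_snd_subset:
  "V \<subseteq> vectors_on (A \<union> B) \<Longrightarrow> negate_snd A B V \<subseteq> vectors_on (A \<union> B)"
  by (auto simp: negate_snd_def join_def vectors_on_def)

lemma perp_subset: "perp X V \<subseteq> vectors_on X"
  by (auto simp: perp_def)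

section \<open>Duality of the intersection-sums\<close>

lemma intersection_sum_fst_perp_subset:
  fixes V W :: "('e \<Rightarrow> 'f::field) set"
  assumes disj: "A \<inter> B = {}"
    and sub: "V \<subseteq> vectors_on (A \<union> B)" "W \<subseteq> vectors_on (A \<union> B)"
  shows "intersection_sum_fst A B (perp (A \<union> B) V) (perp (A \<union> B) W)
    \<subseteq> perp (A \<union> B) (intersection_sum_snd A B V W)"
proof
  fix h
  assume "h \<in> intersection_sum_fst A B (perp (A \<union> B) V) (perp (A \<union> B) W)"
  then obtain g1 g2 where h: "h \<in> vectors_on (A \<union> B)"
    and g: "g1 \<in> perp (A \<union> B) V" "g2 \<in> perp (A \<union> B) W"
    and hA: "\<And>e. e \<in> A \<Longrightarrow> h e = g1 e + g2 e"
    and hB: "\<And>e. e \<in> B \<Longrightarrow> g1 e = h e" "\<And>e. e \<in> B \<Longrightarrow> g2 e = h e"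
    unfolding mem_intersection_sum_fst_iff[OF disj perp_subset perp_subset] by blast
  have "(\<Sum>e\<in>A \<union> B. f e * h e) = 0" if "f \<in> intersection_sum_snd A B V W" for f
  proof -
    obtain v w where vw: "v \<in> V" "w \<in> W"
      and fA: "\<And>e. e \<in> A \<Longrightarrow> v e = f e" "\<And>e. e \<in> A \<Longrightarrow> w e = f e"
      and fB: "\<And>e. e \<in> B \<Longrightarrow> f e = v e + w e"
      using \<open>f \<in> intersection_sum_snd A B V W\<close>
      unfolding mem_intersection_sum_snd_iff[OF disj sub] by blast
    have "(\<Sum>e\<in>A \<union> B. f e * h e) = (\<Sum>e\<in>A \<union> B. v e * g1 e + w e * g2 e)"
      by (rule sum.cong) (auto simp: hA hB fA fB algebra_simps)
    also have "\<dots> = 0"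
      using vw g by (simp add: sum.distrib perp_def)
    finally show ?thesis .
  qed
  then show "h \<in> perp (A \<union> B) (intersection_sum_snd A B V W)"
    using h by (simp add: perp_def)
qed

lemma perp_intersection_sum_snd_subset:
  fixes V W :: "('e \<Rightarrow> 'f::field) set"
  assumes fin: "finite A" "finite B" and disj: "A \<inter> B = {}"
    and V: "linkage A B V" and W: "linkage A B W"
  shows "perp (A \<union> B) (intersection_sum_snd A B V W)
    \<subseteq> intersection_sum_fst A B (perp (A \<union> B) V) (perp (A \<union> B) W)"
proof
  fix h :: "'e \<Rightarrow> 'f"
  assume "h \<in> perp (A \<union> B) (intersection_sum_snd A B V W)"
  then have h: "h \<in> vectors_on (A \<union> B)"
    and orth: "\<And>f. f \<in> intersection_sum_snd A B V W \<Longrightarrow> (\<Sum>e\<in>A \<union> B. f e * h e) = 0"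
    by (auto simp: perp_def)
  have sub: "V \<subseteq> vectors_on (A \<union> B)" "W \<subseteq> vectors_on (A \<union> B)"
    and subsp: "fun_space.subspace V" "fun_space.subspace W"
    using V W by (auto simp: linkage_def)
  have comb: "(\<lambda>e. x e - s * y e) \<in> U" if "fun_space.subspace U" "x \<in> U" "y \<in> U"
    for U :: "('e \<Rightarrow> 'f) set" and x y s
    using fun_space.subspace_diff[OF that(1,2) fun_space.subspace_scale[OF that(1,3), of s]]
    by (simp add: fun_scale_def fun_diff_def)
  have zero: "(\<lambda>e. 0) \<in> V" "(\<lambda>e. 0) \<in> W"
    using subsp[THEN fun_space.subspace_0] by (simp_all add: zero_fun_def)
  have split: "(\<Sum>e\<in>A \<union> B. k e) = (\<Sum>e\<in>A. k e) + (\<Sum>e\<in>B. k e)" for k :: "'e \<Rightarrow> 'f"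
    by (rule sum.union_disjoint[OF fin disj])
  \<comment> \<open>The value that pairing with the first block of \<open>v + w\<close> must take: the condition on \<open>v\<close> asks
      for \<open>- \<langle>h, v\<rangle>\<^sub>B\<close>, the one on \<open>w\<close> for \<open>\<langle>h, w\<rangle>\<close> over both blocks.\<close>
  define c where "c v w = (\<Sum>e\<in>A \<union> B. w e * h e) - (\<Sum>e\<in>B. v e * h e)" for v w
  have c_comb: "c (\<lambda>e. v e - s * v' e) (\<lambda>e. w e - s * w' e) = c v w - s * c v' w'" for v w v' w' s
    by (simp add: c_def sum_subtractf sum_distrib_left algebra_simps)
  let ?R = "{((\<lambda>e. v e + w e), c v w) | v w. v \<in> V \<and> w \<in> W}"
  have "\<exists>u. \<forall>(a, d)\<in>?R. (\<Sum>e\<in>A. u e * a e) = d"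
  proof (rule consistent_system_solvable[OF fin(1)])
    fix a d a' d' s
    assume "(a, d) \<in> ?R" "(a', d') \<in> ?R"
    then obtain v w v' w' where vw: "v \<in> V" "w \<in> W" "v' \<in> V" "w' \<in> W"
      and "a = (\<lambda>e. v e + w e)" "d = c v w" "a' = (\<lambda>e. v' e + w' e)" "d' = c v' w'"
      by blast
    then have "(\<lambda>e. a e - s * a' e) = (\<lambda>e. (v e - s * v' e) + (w e - s * w' e))"
      "d - s * d' = c (\<lambda>e. v e - s * v' e) (\<lambda>e. w e - s * w' e)"
      by (simp_all add: c_comb algebra_simps)
    then show "((\<lambda>e. a e - s * a' e), d - s * d') \<in> ?R"
      using comb[OF subsp(1) vw(1,3), of s] comb[OF subsp(2) vw(2,4), of s] by auto
  next
    fix a d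
    assume "(a, d) \<in> ?R" and "\<And>e. e \<in> A \<Longrightarrow> a e = 0"
    then obtain v w where vw: "v \<in> V" "w \<in> W" and d: "d = c v w"
      and "\<And>e. e \<in> A \<Longrightarrow> v e + w e = 0"
      by blast
    then have neg: "\<And>e. e \<in> A \<Longrightarrow> w e = - v e"
      by (metis add.commute eq_neg_iff_add_eq_0)
    \<comment> \<open>\<open>v\<close> and \<open>- w\<close> agree on \<open>A\<close>, so they can be combined in the intersection-sum.\<close>
    let ?f = "\<lambda>e. if e \<in> A then v e else v e - w e"
    have neg_w: "(\<lambda>e. - w e) \<in> W"
      using comb[OF subsp(2) zero(2) vw(2), of 1] by simp
    have f_vec: "?f \<in> vectors_on (A \<union> B)"
      using subsetD[OF sub(1) vw(1)] subsetD[OF sub(2) vw(2)] by (simp add: vectors_on_def)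
    have f_eq: "(\<forall>e\<in>A. v e = ?f e \<and> - w e = ?f e) \<and> (\<forall>e\<in>B. ?f e = v e + - w e)"
      using neg disj by auto
    have "?f \<in> intersection_sum_snd A B V W"
      unfolding mem_intersection_sum_snd_iff[OF disj sub]
      by (intro conjI[OF f_vec] bexI[OF _ vw(1)] bexI[OF _ neg_w]) (rule f_eq)
    then have "(\<Sum>e\<in>A \<union> B. ?f e * h e) = 0" by (rule orth)
    moreover have "(\<Sum>e\<in>A. ?f e * h e) = - (\<Sum>e\<in>A. w e * h e)"
      unfolding sum_negf[symmetric] by (rule sum.cong) (auto simp: neg)
    moreover have "(\<Sum>e\<in>B. ?f e * h e) = (\<Sum>e\<in>B. v e * h e) - (\<Sum>e\<in>B. w e * h e)"
      unfolding sum_subtractf[symmetric]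
      by (rule sum.cong) (use disj in \<open>auto simp: algebra_simps\<close>)
    ultimately show "d = 0"
      unfolding d c_def split by (simp add: algebra_simps)
  qed
  then obtain u where u_sol: "\<forall>(a, d)\<in>?R. (\<Sum>e\<in>A. u e * a e) = d" ..
  have u: "(\<Sum>e\<in>A. u e * (v e + w e)) = c v w" if "v \<in> V" "w \<in> W" for v w
  proof -
    have "((\<lambda>e. v e + w e), c v w) \<in> ?R"
      unfolding mem_Collect_eq by (rule exI[of _ v], rule exI[of _ w]) (simp add: that)
    from bspec[OF u_sol this] show ?thesis by simp
  qed
  let ?g1 = "\<lambda>e. if e \<in> A then u e else h e"
  let ?g2 = "\<lambda>e. if e \<in> A then h e - u e else h e"
  have B_not_A: "e \<notin> A" if "e \<in> B" for e using that disj by auto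
  have g1: "?g1 \<in> perp (A \<union> B) V"
  proof -
    have "(\<Sum>e\<in>A \<union> B. v e * ?g1 e) = 0" if "v \<in> V" for v
      using u[OF that zero(2)]
      by (simp add: split c_def B_not_A mult.commute cong: sum.cong)
    then show ?thesis using h by (auto simp: perp_def vectors_on_def)
  qed
  have g2: "?g2 \<in> perp (A \<union> B) W"
  proof -
    have "(\<Sum>e\<in>A \<union> B. w e * ?g2 e) = 0" if "w \<in> W" for w
      using u[OF zero(1) that]
      by (simp add: split c_def B_not_A right_diff_distrib sum_subtractf mult.commute cong: sum.cong)
    then show ?thesis using h by (auto simp: perp_def vectors_on_def)
  qed
  have h_eq: "(\<forall>e\<in>A. h e = ?g1 e + ?g2 e) \<and> (\<forall>e\<in>B. ?g1 e = h e \<and> ?g2 e = h e)"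
    using disj by auto
  show "h \<in> intersection_sum_fst A B (perp (A \<union> B) V) (perp (A \<union> B) W)"
    unfolding mem_intersection_sum_fst_iff[OF disj perp_subset perp_subset]
    by (intro conjI[OF h] bexI[OF _ g1] bexI[OF _ g2]) (rule h_eq)
qed

lemma negate_snd_intersection_sum_fst:
  fixes V W :: "('e \<Rightarrow> 'f::field) set"
  assumes disj: "A \<inter> B = {}" and sub: "V \<subseteq> vectors_on (A \<union> B)" "W \<subseteq> vectors_on (A \<union> B)"
  shows "negate_snd A B (intersection_sum_fst A B V W)
    = intersection_sum_fst A B (negate_snd A B V) (negate_snd A B W)"
proof -
  define n where "n h = (\<lambda>e. if e \<in> B then - h e else h e)" for h :: "'e \<Rightarrow> 'f"
  have n_A: "n h e = h e" if "e \<in> A" for h e using that disj by (auto simp: n_def)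
  have n_B: "n h e = - h e" if "e \<in> B" for h e using that by (simp add: n_def)
  have inv: "n (n h) = h" for h by (simp add: n_def fun_eq_iff)
  have vec: "n h \<in> vectors_on (A \<union> B) \<longleftrightarrow> h \<in> vectors_on (A \<union> B)" for h
    by (auto simp: vectors_on_def n_def)
  have neg_iff: "h \<in> negate_snd A B U \<longleftrightarrow> n h \<in> U" if "U \<subseteq> vectors_on (A \<union> B)" for h U
    unfolding n_def by (rule mem_negate_snd_iff[OF disj that])
  have sum_sub: "intersection_sum_fst A B V W \<subseteq> vectors_on (A \<union> B)"
    using mem_intersection_sum_fst_iff[OF disj sub] by blast
  note sum_iff = mem_intersection_sum_fst_iff[OF disj sub]
    mem_intersection_sum_fst_iff[OF disj sub[THEN negate_snd_subset]]
  show ?thesis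
  proof (intro set_eqI iffI)
    fix h
    assume "h \<in> negate_snd A B (intersection_sum_fst A B V W)"
    then obtain v w where h: "h \<in> vectors_on (A \<union> B)" and "v \<in> V" "w \<in> W"
      and A: "\<And>e. e \<in> A \<Longrightarrow> n h e = v e + w e"
      and B: "\<And>e. e \<in> B \<Longrightarrow> v e = n h e" "\<And>e. e \<in> B \<Longrightarrow> w e = n h e"
      unfolding neg_iff[OF sum_sub] sum_iff vec by blast
    then have "n v \<in> negate_snd A B V" "n w \<in> negate_snd A B W"
      by (simp_all add: neg_iff sub inv)
    moreover have "\<forall>e\<in>A. h e = n v e + n w e"
      using A n_A by simp
    moreover have "\<forall>e\<in>B. n v e = h e \<and> n w e = h e"
      using B n_B by simp
    ultimately show "h \<in> intersection_sum_fst A B (negate_snd A B V) (negate_snd A B W)"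
      unfolding sum_iff using h by blast
  next
    fix h
    assume "h \<in> intersection_sum_fst A B (negate_snd A B V) (negate_snd A B W)"
    then obtain v w where h: "h \<in> vectors_on (A \<union> B)" and "n v \<in> V" "n w \<in> W"
      and A: "\<And>e. e \<in> A \<Longrightarrow> h e = v e + w e"
      and B: "\<And>e. e \<in> B \<Longrightarrow> v e = h e" "\<And>e. e \<in> B \<Longrightarrow> w e = h e"
      unfolding sum_iff Bex_def neg_iff[OF sub(1)] neg_iff[OF sub(2)] by blast
    moreover have "\<forall>e\<in>A. n h e = n v e + n w e"
      using A n_A by simp
    moreover have "\<forall>e\<in>B. n v e = n h e \<and> n w e = n h e"
      using B n_B by simp
    ultimately show "h \<in> negate_snd A B (intersection_sum_fst A B V W)"
      unfolding neg_iff[OF sum_sub] sum_iff vec by blast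
  qed
qed

theorem theorem20:
  fixes A B :: "'e set" and V W :: "('e \<Rightarrow> 'f::field) set"
  assumes "finite A" and "finite B" and "A \<inter> B = {}"
    and "linkage A B V" and "linkage A B W"
  shows "perp (A \<union> B) (intersection_sum_snd A B V W)
           = intersection_sum_fst A B (perp (A \<union> B) V) (perp (A \<union> B) W)
       \<and> transpose_linkage A B (intersection_sum_snd A B V W)
           = intersection_sum_fst A B (transpose_linkage A B V) (transpose_linkage A B W)"
proof -
  have "V \<subseteq> vectors_on (A \<union> B)" "W \<subseteq> vectors_on (A \<union> B)"
    using assms(4,5) by (auto simp: linkage_def)
  then have perp: "perp (A \<union> B) (intersection_sum_snd A B V W)
      = intersection_sum_fst A B (perp (A \<union> B) V) (perp (A \<union> B) W)"
    using perp_intersection_sum_snd_subset[OF assms]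
      intersection_sum_fst_perp_subset[OF assms(3)] by blast
  moreover have "transpose_linkage A B (intersection_sum_snd A B V W)
      = intersection_sum_fst A B (transpose_linkage A B V) (transpose_linkage A B W)"
    unfolding transpose_linkage_def perp
    by (rule negate_snd_intersection_sum_fst[OF assms(3) perp_subset perp_subset])
  ultimately show ?thesis ..
qed

end
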